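(* Let $s_1,s_2,\lambda\in\mathbb{C}$ with $\Re(s_1)>0$ and $\lambda\notin\mathbb{Z}_{<0}$. Then $$D(s_1,s_2;\lambda)=\int_{0}^{\infty}\frac{t^{s_1-1}e^{-t}}{e^{t}-1}\sum_{k=1}^{\infty}\frac{t^k(k+\lambda)^{-s_2}}{\Gamma(s_1+k)}\,dt .$$
   Context: $\zeta$ is the Riemann zeta function and $\Gamma$ the gamma function. For $s_1,s_2\in\mathbb{C}$ with $s_1\notin\mathbb{Z}_{\le 0}$ and $\lambda\in\mathbb{C}$ with $\lambda\notin\mathbb{Z}_{<0}$, $$D(s_1,s_2;\lambda):=\sum_{k=1}^{\infty}\frac{\zeta(s_1+k)-1}{(k+\lambda)^{s_2}},$$ where powers of $k+\lambda$ are taken with the principal branch of the logarithm. *)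

theory Defs
  imports "HOL-Complex_Analysis.Complex_Analysis"
begin

(* The Dirichlet series on Re s > 1, and elsewhere the value at s of its (unique) analytic
   continuation to the complement of {1}.  The value at the pole s = 1 is the dummy value 0. *)
definition riemann_zeta :: "complex \<Rightarrow> complex" where
  "riemann_zeta s =
     (if Re s > 1 then (\<Sum>n. of_nat (Suc n) powr (- s))
      else if s = 1 then 0
      else (THE z. \<exists>f. f holomorphic_on (- {1}) \<and>
              (\<forall>w. Re w > 1 \<longrightarrow> f w = (\<Sum>n. of_nat (Suc n) powr (- w))) \<and> z = f s))"

(* Series over k >= 1 are written with Suc k.  Complex powr uses Ln, the principal branch. *)
definition D_term :: "complex \<Rightarrow> complex \<Rightarrow> complex \<Rightarrow> nat \<Rightarrow> complex" where
  "D_term s1 s2 lam k = (riemann_zeta (s1 + of_nat k) - 1) / (of_nat k + lam) powr s2"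

definition D :: "complex \<Rightarrow> complex \<Rightarrow> complex \<Rightarrow> complex" where
  "D s1 s2 lam = (\<Sum>k. D_term s1 s2 lam (Suc k))"

definition inner_term :: "complex \<Rightarrow> complex \<Rightarrow> complex \<Rightarrow> real \<Rightarrow> nat \<Rightarrow> complex" where
  "inner_term s1 s2 lam t k =
     of_real t ^ k * (of_nat k + lam) powr (- s2) / Gamma (s1 + of_nat k)"

definition D_integrand :: "complex \<Rightarrow> complex \<Rightarrow> complex \<Rightarrow> real \<Rightarrow> complex" where
  "D_integrand s1 s2 lam t =
     of_real t powr (s1 - 1) * exp (- of_real t) / (exp (of_real t) - 1) *
       (\<Sum>k. inner_term s1 s2 lam t (Suc k))"

end

theory Submission
  imports Defs "HOL-Real_Asymp.Real_Asymp"
begin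

text \<open>
  Expanding \<open>exp (-t) / (exp t - 1)\<close> as a geometric series and integrating term by term gives
  \<open>\<Gamma>(s) (\<zeta>(s) - 1)\<close> as the integral of \<open>t powr (s - 1) * exp (-t) / (exp t - 1)\<close> for \<open>Re s > 1\<close>.
  Apply this at \<open>s = s1 + k\<close>, divide by \<open>\<Gamma>(s1 + k)\<close> and exchange the sum over \<open>k\<close> with the
  integral. The exchange is justified by absolute convergence: the integral of the absolute value
  of the \<open>k\<close>-th term involves \<open>\<Gamma>(Re s1 + k) / |\<Gamma>(s1 + k)|\<close>, which is bounded because the functional
  equation makes it decrease in \<open>k\<close>; \<open>\<zeta>(Re s1 + k) - 1\<close> decays like \<open>2^(-k)\<close>; and
  \<open>|(k + lam) powr (- s2)|\<close> grows at most polynomially.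
\<close>

section \<open>Euler's integral with a scaled exponential\<close>

text \<open>Substituting \<open>a * t\<close> in Euler's integral produces
  \<open>a powr (s - 1)\<close> and the Jacobian \<open>1 / a\<close>; solving for the remaining
  integral leaves \<open>a powr (- s)\<close>. For \<open>a = n + 2\<close> these are the terms of
  the Dirichlet series.\<close>

lemma has_bochner_integral_Gamma_scaled:
  fixes s :: complex and a :: real
  assumes s: "Re s > 0" and a: "a > 0"
  shows "has_bochner_integral lborel
    (\<lambda>t. indicator {0<..} t *\<^sub>R (of_real t powr (s - 1) * of_real (exp (- (a * t)))))
    (Gamma s * of_real a powr (- s))"
proof -
  define g :: "real \<Rightarrow> complex" where
    "g = (\<lambda>t. indicator {0<..} t *\<^sub>R (of_real t powr (s - 1) / of_real (exp t)))"
  have meas: "g \<in> borel_measurable lborel"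
    unfolding g_def measurable_lborel2
    by (intro borel_measurable_continuous_on_indicator continuous_intros) auto
  \<comment> \<open>Absolute integrability refers to Lebesgue measure, the completion of
    \<open>lborel\<close>; Borel measurability of \<open>g\<close> brings it down to
    \<open>lborel\<close>.\<close>
  have "integrable (completion lborel) g"
    using absolutely_integrable_Gamma_integral'[OF s]
    unfolding set_integrable_def g_def by simp
  hence int: "integrable lborel g"
    using integrable_completion[OF meas] by simp
  hence "set_integrable lborel {0<..} (\<lambda>t. complex_of_real t powr (s - 1) / of_real (exp t))"
    unfolding set_integrable_def g_def .
  from set_borel_integral_eq_integral(2)[OF this] Gamma_integral_complex'[OF s]
  have "integral\<^sup>L lborel g = Gamma s"
    unfolding set_lebesgue_integral_def g_def by (simp add: integral_unique)
  with int have "has_bochner_integral lborel g (Gamma s)"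
    by (simp add: has_bochner_integral_iff)
  hence "has_bochner_integral lborel (\<lambda>t. g (0 + a * t)) (Gamma s /\<^sub>R \<bar>a\<bar>)"
    using a by (subst (asm) lborel_has_bochner_integral_real_affine_iff[of a _ _ 0]) auto
  hence "has_bochner_integral lborel (\<lambda>t. of_real a powr (1 - s) * g (0 + a * t))
           (of_real a powr (1 - s) * (Gamma s /\<^sub>R \<bar>a\<bar>))"
    by (rule has_bochner_integral_mult_right)
  moreover have "of_real a powr (1 - s) * (Gamma s /\<^sub>R \<bar>a\<bar>) = Gamma s * of_real a powr (- s)"
    using a by (simp add: powr_diff powr_minus scaleR_conv_of_real field_simps)
  moreover have "of_real a powr (1 - s) * g (0 + a * t) =
      indicator {0<..} t *\<^sub>R (of_real t powr (s - 1) * of_real (exp (- (a * t))))" for t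
  proof (cases "t > 0")
    case True
    have "of_real a powr (1 - s) * of_real (a * t) powr (s - 1) = of_real t powr (s - 1)"
      using a True by (simp add: powr_times_real powr_diff field_simps)
    thus ?thesis
      using True a by (simp add: g_def exp_minus divide_inverse mult.assoc [symmetric])
  next
    case False
    thus ?thesis using a by (simp add: g_def zero_less_mult_iff)
  qed
  ultimately show ?thesis by (simp cong: has_bochner_integral_cong)
qed

section \<open>The Dirichlet series of zeta minus 1 and its decay\<close>

lemma summable_shifted_powr:
  assumes "(c::real) > 1"
  shows "summable (\<lambda>n. (real n + 2) powr (- c))"
proof -
  have "summable (\<lambda>n. real n powr (- c))"
    using assms by (simp add: summable_real_powr_iff)
  hence "summable (\<lambda>n. real (n + 2) powr (- c))"
    by (rule summable_ignore_initial_segment)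
  thus ?thesis by (simp add: add_ac)
qed

lemma norm_nat_plus_2_powr: "norm ((of_nat n + 2 :: complex) powr s) = (real n + 2) powr Re s"
proof -
  have "norm (of_real (real n + 2) powr s) = (real n + 2) powr Re s"
    by (subst norm_powr_real_powr) auto
  thus ?thesis by simp
qed

text \<open>Subtracting 1 removes the first term, so the bases start at 2. In this half-plane the
  definition of \<open>riemann_zeta\<close> is the series itself; all arguments
  \<open>s1 + k\<close> with \<open>Re s1 > 0\<close> and \<open>k >= 1\<close> lie in it.\<close>

lemma riemann_zeta_minus_1_sums:
  assumes "Re s > 1"
  shows "(\<lambda>n. (of_nat n + 2) powr (- s)) sums (riemann_zeta s - 1)"
proof -
  have "summable (\<lambda>n. norm ((of_nat n + 2 :: complex) powr (- s)))"
    using summable_shifted_powr[OF assms] by (simp add: norm_nat_plus_2_powr)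
  hence "summable (\<lambda>n. (of_nat n + 2 :: complex) powr (- s))"
    by (rule summable_norm_cancel)
  hence *: "summable (\<lambda>n. of_nat (Suc (Suc n)) powr (- s) :: complex)"
    by (simp add: add_ac)
  hence **: "summable (\<lambda>n. of_nat (Suc n) powr (- s) :: complex)"
    by (subst summable_Suc_iff [symmetric])
  have "riemann_zeta s = (\<Sum>n. of_nat (Suc n) powr (- s))"
    using assms by (simp add: riemann_zeta_def)
  also have "\<dots> = (\<Sum>n. of_nat (Suc (Suc n)) powr (- s)) + 1"
    using suminf_split_head[OF **] by simp
  finally show ?thesis
    using summable_sums[OF *] by (simp add: add_ac)
qed

text \<open>Every base is at least 2, so raising the exponent by \<open>k\<close> gains a factor
  \<open>(1/2) ^ k\<close> in each term, and the remaining sum does not depend on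
  \<open>k\<close>.\<close>

lemma norm_riemann_zeta_minus_1_le:
  assumes "Re s > 1"
  shows "norm (riemann_zeta (s + of_nat k) - 1) \<le> (1/2) ^ k * (\<Sum>n. (real n + 2) powr (- Re s))"
proof -
  have le: "norm ((of_nat n + 2 :: complex) powr (- (s + of_nat k))) \<le>
      (1/2) ^ k * (real n + 2) powr (- Re s)" for n
  proof -
    have "norm ((of_nat n + 2 :: complex) powr (- (s + of_nat k))) =
        (real n + 2) powr (- Re s - real k)"
      by (simp add: norm_nat_plus_2_powr del: minus_add_distrib) simp
    also have "\<dots> = (real n + 2) powr (- Re s) * (1 / (real n + 2)) ^ k"
      by (simp add: powr_diff powr_realpow power_divide)
    also have "(1 / (real n + 2)) ^ k \<le> (1/2) ^ k"
      by (intro power_mono) (auto simp: field_simps)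
    finally show ?thesis by (simp add: mult_left_mono mult.commute)
  qed
  have sm: "summable (\<lambda>n. (1/2) ^ k * (real n + 2) powr (- Re s))"
    by (intro summable_mult summable_shifted_powr assms)
  have "riemann_zeta (s + of_nat k) - 1 = (\<Sum>n. (of_nat n + 2) powr (- (s + of_nat k)))"
    using riemann_zeta_minus_1_sums[of "s + of_nat k"] assms by (simp add: sums_iff)
  also have "norm \<dots> \<le> (\<Sum>n. (1/2) ^ k * (real n + 2) powr (- Re s))"
    by (rule norm_suminf_le[OF le sm])
  also have "\<dots> = (1/2) ^ k * (\<Sum>n. (real n + 2) powr (- Re s))"
    by (rule suminf_mult[OF summable_shifted_powr[OF assms]])
  finally show ?thesis .
qed

section \<open>The integral formula for Gamma(s) (zeta(s) - 1)\<close>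

text \<open>The outer factor of \<open>D_integrand\<close>, extended by 0 to \<open>t <= 0\<close>
  so that all integrals run over the whole line.\<close>

definition zeta_kernel :: "complex \<Rightarrow> real \<Rightarrow> complex" where
  "zeta_kernel s t = indicator {0<..} t *\<^sub>R
     (of_real t powr (s - 1) * exp (- of_real t) / (exp (of_real t) - 1))"

text \<open>The limit equals \<open>exp (- 2 * t) / (1 - exp (- t))\<close>, a geometric series with
  ratio \<open>exp (- t)\<close>. Its leading exponent 2 matches the missing first term of zeta
  minus 1.\<close>

lemma exp_geometric_sums:
  fixes t :: real
  assumes "t > 0"
  shows "(\<lambda>n. exp (- ((real n + 2) * t))) sums (exp (- t) / (exp t - 1))"
proof -
  have "(\<lambda>n. exp (- t) ^ n) sums (1 / (1 - exp (- t)))"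
    using assms by (intro geometric_sums) auto
  hence "(\<lambda>n. exp (- 2 * t) * exp (- t) ^ n) sums (exp (- 2 * t) * (1 / (1 - exp (- t))))"
    by (rule sums_mult)
  moreover have "exp (- 2 * t) * exp (- t) ^ n = exp (- ((real n + 2) * t))" for n
    by (simp add: exp_of_nat_mult [symmetric] exp_add [symmetric] algebra_simps)
  moreover have "exp (- 2 * t) * (1 / (1 - exp (- t))) = exp (- t) / (exp t - 1)"
  proof -
    have "exp (- 2 * t) = exp (- t) * exp (- t)" by (simp add: exp_add [symmetric])
    moreover have "exp t \<noteq> 1" using assms by simp
    ultimately show ?thesis by (simp add: exp_minus field_simps)
  qed
  ultimately show ?thesis by simp
qed

text \<open>Only the power of \<open>t\<close> is non-real, and its modulus depends on
  \<open>Re s\<close> alone. Integrals of norms are thus given by the same formula at a real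
  argument.\<close>

lemma norm_zeta_kernel: "norm (zeta_kernel s t) = Re (zeta_kernel (of_real (Re s)) t)"
proof (cases "t > 0")
  case True
  have "zeta_kernel s t = of_real t powr (s - 1) * of_real (exp (- t) / (exp t - 1))" for s
    using True by (simp add: zeta_kernel_def exp_of_real [symmetric])
  moreover have "of_real t powr (of_real (Re s) - 1) = complex_of_real (t powr (Re s - 1))"
    using True by (simp add: powr_of_real [symmetric])
  moreover have "norm (of_real t powr (s - 1) :: complex) = t powr (Re s - 1)"
    using True by (subst norm_powr_real_powr) auto
  ultimately show ?thesis
    using True by (simp add: norm_mult norm_divide del: of_real_divide)
qed (simp add: zeta_kernel_def)

text \<open>The geometric series is integrated term by term. The norms of the terms have integrals
  \<open>Gamma (Re s) * (n + 2) powr (- Re s)\<close>, which are summable because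
  \<open>Re s > 1\<close>.\<close>

lemma has_bochner_integral_zeta_kernel:
  assumes s: "Re s > 1"
  shows "has_bochner_integral lborel (zeta_kernel s) (Gamma s * (riemann_zeta s - 1))"
proof -
  \<comment> \<open>The exponent is an argument of \<open>f\<close> because the integral of the norm
    is computed from the same function at \<open>Re s\<close>.\<close>
  define f where "f = (\<lambda>s n t. indicator {0<..} t *\<^sub>R
    (complex_of_real t powr (s - 1) * of_real (exp (- ((real n + 2) * t)))))"
  have f: "has_bochner_integral lborel (f s n) (Gamma s * (of_nat n + 2) powr (- s))"
    if "Re s > 0" for s n
    using has_bochner_integral_Gamma_scaled[of s "real n + 2"] that by (simp add: f_def)
  have norm_f: "norm (f s n t) = indicator {0<..} t * (t powr (Re s - 1) * exp (- ((real n + 2) * t)))" for n t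
    by (auto simp: f_def norm_mult norm_powr_real_powr indicator_def)
  have norm_f': "norm (f s n t) = Re (f (of_real (Re s)) n t)" for n t
  proof (cases "t > 0")
    case True
    have "of_real t powr (of_real (Re s) - 1) = complex_of_real (t powr (Re s - 1))"
      using True by (simp add: powr_of_real [symmetric])
    thus ?thesis using True unfolding norm_f by (simp add: f_def)
  qed (simp add: f_def)
  have sums: "(\<lambda>n. f s n t) sums zeta_kernel s t" for t
  proof (cases "t > 0")
    case True
    have "(\<lambda>n. of_real t powr (s - 1) * of_real (exp (- ((real n + 2) * t)))) sums
       (of_real t powr (s - 1) * complex_of_real (exp (- t) / (exp t - 1)))"
      by (intro sums_mult sums_of_real exp_geometric_sums True)
    thus ?thesis
      using True by (simp add: f_def zeta_kernel_def exp_of_real [symmetric])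
  qed (simp add: f_def zeta_kernel_def)
  have sm_ptwise: "summable (\<lambda>n. norm (f s n t))" for t
  proof (cases "t > 0")
    case True
    thus ?thesis unfolding norm_f
      by (intro summable_mult sums_summable[OF exp_geometric_sums])
  qed (simp add: f_def)
  have int_norm: "(\<integral>t. norm (f s n t) \<partial>lborel) = Gamma (Re s) * (real n + 2) powr (- Re s)" for n
  proof -
    have "has_bochner_integral lborel (\<lambda>t. Re (f (of_real (Re s)) n t))
            (Re (Gamma (of_real (Re s)) * (of_nat n + 2) powr (- of_real (Re s))))"
      using s by (intro has_bochner_integral_Re f) auto
    moreover have "(of_nat n + 2) powr (- of_real (Re s)) = complex_of_real ((real n + 2) powr (- Re s))"
      by (subst powr_of_real [symmetric]) auto
    ultimately show ?thesis
      unfolding norm_f' by (simp add: has_bochner_integral_iff Gamma_complex_of_real)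
  qed
  have int: "integrable lborel (f s n)" for n
    using f[of s n] s by (simp add: has_bochner_integral_iff)
  have sm: "summable (\<lambda>n. \<integral>t. norm (f s n t) \<partial>lborel)"
    unfolding int_norm by (intro summable_mult summable_shifted_powr s)
  have eq: "(\<lambda>t. \<Sum>n. f s n t) = zeta_kernel s"
    using sums by (auto simp: sums_iff)
  have "integrable lborel (\<lambda>t. \<Sum>n. f s n t)"
    by (intro integrable_suminf int AE_I2 sm_ptwise sm)
  moreover have "(\<lambda>n. integral\<^sup>L lborel (f s n)) sums (\<integral>t. (\<Sum>n. f s n t) \<partial>lborel)"
    by (intro sums_integral int AE_I2 sm_ptwise sm)
  moreover have "(\<lambda>n. integral\<^sup>L lborel (f s n)) sums (Gamma s * (riemann_zeta s - 1))"
    using f s sums_mult[OF riemann_zeta_minus_1_sums[OF s], of "Gamma s"]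
    by (simp add: has_bochner_integral_iff)
  ultimately show ?thesis
    unfolding eq has_bochner_integral_iff by (auto dest: sums_unique2)
qed

section \<open>Comparison of complex and real Gamma values\<close>

text \<open>Each factor \<open>s + j\<close> has modulus at least its real part
  \<open>Re s + j\<close>, and these are positive, so the inequalities multiply.\<close>

lemma norm_pochhammer_ge:
  assumes "Re s > 0"
  shows "pochhammer (Re s) k \<le> norm (pochhammer s k)"
proof (induction k)
  case (Suc k)
  have "Re s + real k \<le> norm (s + of_nat k)"
    using complex_Re_le_cmod[of "s + of_nat k"] by simp
  with Suc assms show ?case
    by (auto simp: pochhammer_Suc norm_mult intro!: mult_mono)
qed simp

lemma Re_pos_not_nonpos_Ints: "Re s > 0 \<Longrightarrow> s \<notin> \<int>\<^sub>\<le>\<^sub>0"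
  by (auto elim!: nonpos_Ints_cases)

text \<open>By the functional equation both shifted values are Pochhammer symbols times unshifted
  ones. In quotient form, \<open>Gamma (Re s + k) / norm (Gamma (s + k))\<close> never exceeds its
  value at \<open>k = 0\<close>.\<close>

lemma norm_Gamma_plus_of_nat_ge:
  assumes s: "Re s > 0"
  shows "Gamma (Re s + real k) * norm (Gamma s) \<le> Gamma (Re s) * norm (Gamma (s + of_nat k))"
proof -
  have [simp]: "s \<notin> \<int>\<^sub>\<le>\<^sub>0" "Re s \<notin> \<int>\<^sub>\<le>\<^sub>0"
    using s by (auto elim!: nonpos_Ints_cases)
  have "Gamma (Re s + real k) = pochhammer (Re s) k * Gamma (Re s)"
    using s by (simp add: pochhammer_Gamma Gamma_eq_zero_iff)
  moreover have "Gamma (s + of_nat k) = pochhammer s k * Gamma s"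
    using s by (simp add: pochhammer_Gamma Gamma_eq_zero_iff)
  ultimately show ?thesis
    using norm_pochhammer_ge[OF s, of k] Gamma_real_pos[OF s]
    by (simp add: norm_mult mult_ac mult_left_mono mult_right_mono)
qed

section \<open>Growth of the coefficients and convergence of the inner series\<close>

text \<open>The modulus of \<open>z powr s\<close> is \<open>norm z powr Re s\<close> times
  \<open>exp (- Im s * Arg z)\<close>. The second factor is bounded since \<open>Arg\<close> is, so
  the growth in \<open>k\<close> is at most polynomial and \<open>(1/2) ^ k\<close> wins.\<close>

lemma summable_norm_shifted_powr_half_power:
  fixes s lam :: complex
  shows "summable (\<lambda>k. norm ((of_nat (Suc k) + lam) powr s) * (1/2) ^ k)"
proof (rule summable_comparison_test_bigo)
  \<comment> \<open>The ratio 3/4 is 3/2 times 1/2: the polynomial growth is absorbed into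
    \<open>(3/2) ^ k\<close>.\<close>
  show "summable (\<lambda>k. norm ((3/4 :: real) ^ k))" by (simp add: summable_geometric)
next
  define b where "b = norm lam"
  define c where "c = \<bar>Re s\<bar>"
  define C where "C = exp (\<bar>Im s\<bar> * pi)"
  have "norm ((of_nat (Suc k) + lam) powr s) \<le> C * (real k + 1 + b) powr c"
    if k: "real k \<ge> b" for k
  proof -
    let ?z = "of_nat (Suc k) + lam"
    \<comment> \<open>A base of modulus at least 1 allows the exponent \<open>Re s\<close> to be
      raised to \<open>c\<close>; this is why \<open>k >= b\<close> is imposed.\<close>
    have lo: "1 \<le> norm ?z"
      using norm_diff_ineq[of "of_nat (Suc k)" lam] k by (simp add: b_def del: of_nat_Suc)
    have up: "norm ?z \<le> real k + 1 + b"
      using norm_triangle_ineq[of "of_nat (Suc k)" lam] unfolding norm_of_nat by (simp add: b_def)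
    have "norm ?z powr Re s \<le> norm ?z powr c"
      using lo by (intro powr_mono) (auto simp: c_def)
    also have "\<dots> \<le> (real k + 1 + b) powr c"
      using up by (intro powr_mono2) (auto simp: c_def)
    finally have 1: "norm ?z powr Re s \<le> (real k + 1 + b) powr c" .
    have "- Im s * Arg ?z \<le> \<bar>Im s\<bar> * \<bar>Arg ?z\<bar>"
      using abs_ge_self[of "- Im s * Arg ?z"] by (simp add: abs_mult)
    also have "\<dots> \<le> \<bar>Im s\<bar> * pi"
      using Arg_bounded[of ?z] by (intro mult_left_mono) auto
    finally have 2: "exp (- Im s * Arg ?z) \<le> C" by (simp add: C_def)
    have "norm (?z powr s) = exp (- Im s * Arg ?z) * norm ?z powr Re s"
      by (simp add: norm_powr_complex)
    also have "\<dots> \<le> C * (real k + 1 + b) powr c"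
      using 1 2 by (intro mult_mono) (auto simp: C_def)
    finally show ?thesis .
  qed
  hence "eventually (\<lambda>k. norm ((of_nat (Suc k) + lam) powr s) \<le> C * (real k + 1 + b) powr c) sequentially"
    using eventually_ge_at_top[of "nat \<lceil>b\<rceil>"] by (auto elim!: eventually_mono simp: nat_ceiling_le_eq)
  hence "(\<lambda>k. norm ((of_nat (Suc k) + lam) powr s)) \<in> O(\<lambda>k. (real k + 1 + b) powr c)"
    by (intro bigoI[of _ C]) (auto elim!: eventually_mono)
  moreover have "(\<lambda>k. (real k + 1 + b) powr c) \<in> O(\<lambda>k. (3/2) ^ k)"
    by real_asymp
  ultimately have "(\<lambda>k. norm ((of_nat (Suc k) + lam) powr s)) \<in> O(\<lambda>k. (3/2) ^ k)"
    by (rule landau_o.big_trans)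
  hence "(\<lambda>k. norm ((of_nat (Suc k) + lam) powr s) * (1/2) ^ k) \<in> O(\<lambda>k. (3/2) ^ k * (1/2) ^ k)"
    by (intro landau_o.big.mult) auto
  thus "(\<lambda>k. norm ((of_nat (Suc k) + lam) powr s) * (1/2) ^ k) \<in> O(\<lambda>k. (3/4) ^ k)"
    by (simp add: power_mult_distrib [symmetric])
qed

text \<open>The functional equation multiplies by \<open>x\<close> once and then by factors
  \<open>x + j >= j\<close>, which build up the factorial.\<close>

lemma Gamma_plus_Suc_ge:
  assumes "(x::real) > 0"
  shows "Gamma (x + real (Suc k)) \<ge> Gamma x * x * fact k"
proof (induction k)
  case 0
  have "x \<notin> \<int>\<^sub>\<le>\<^sub>0" using assms by (auto elim!: nonpos_Ints_cases)
  thus ?case using Gamma_plus1[of x] by (simp add: mult_ac add_ac)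
next
  case (Suc k)
  have pos: "x + real (Suc k) > 0" using assms by simp
  hence "x + real (Suc k) \<notin> \<int>\<^sub>\<le>\<^sub>0" by (auto elim!: nonpos_Ints_cases simp del: of_nat_Suc)
  hence "Gamma (x + real (Suc (Suc k))) = (x + real (Suc k)) * Gamma (x + real (Suc k))"
    using Gamma_plus1[of "x + real (Suc k)"] by (simp add: add_ac)
  also have "\<dots> \<ge> real (Suc k) * (Gamma x * x * fact k)"
    using Suc assms Gamma_real_pos[OF assms] by (intro mult_mono) auto
  finally show ?case by (simp add: mult_ac)
qed

text \<open>The modulus of \<open>Gamma (s1 + k)\<close> grows factorially, which beats
  \<open>t ^ k\<close> for each fixed \<open>t\<close> together with the polynomial
  coefficients.\<close>

lemma summable_norm_inner_term:
  assumes s1: "Re s1 > 0" and t: "t > 0"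
  shows "summable (\<lambda>k. norm (inner_term s1 s2 lam t (Suc k)))"
proof -
  define x where "x = Re s1"
  define A where "A = (\<lambda>k. norm ((of_nat (Suc k) + lam) powr (- s2)))"
  have x: "x > 0" using s1 by (simp add: x_def)
  define R where "R = norm (Gamma s1)"
  have [simp]: "s1 \<notin> \<int>\<^sub>\<le>\<^sub>0" using s1 by (rule Re_pos_not_nonpos_Ints)
  have R: "R > 0" by (simp add: R_def Gamma_eq_zero_iff)
  have lower: "R * x * fact k \<le> norm (Gamma (s1 + of_nat (Suc k)))" for k
  proof -
    have "Gamma x * (R * x * fact k) \<le> R * Gamma (x + real (Suc k))"
      using mult_left_mono[OF Gamma_plus_Suc_ge[OF x, of k], of R] R by (simp add: mult_ac)
    also have "\<dots> \<le> Gamma x * norm (Gamma (s1 + of_nat (Suc k)))"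
      using norm_Gamma_plus_of_nat_ge[OF s1, of "Suc k"] by (simp add: R_def x_def mult_ac)
    finally show ?thesis
      using Gamma_real_pos[OF x] by (subst (asm) mult_le_cancel_left_pos) auto
  qed
  have sA: "summable (\<lambda>k. A k * (1/2) ^ k)"
    unfolding A_def by (rule summable_norm_shifted_powr_half_power)
  \<comment> \<open>Splitting \<open>t ^ k\<close> as \<open>(1/2) ^ k * (2 * t) ^ k\<close> saves
    the weight needed for the coefficients; the rest over \<open>fact k\<close> is eventually below
    1.\<close>
  have "(\<lambda>k. (2 * t) ^ k / fact k) \<longlonglongrightarrow> 0"
    using summable_LIMSEQ_zero[OF summable_exp[of "2 * t"]] by (simp add: field_simps)
  hence "eventually (\<lambda>k. (2 * t) ^ k / fact k < 1) sequentially"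
    by (rule order_tendstoD) simp
  hence "eventually (\<lambda>k. norm (norm (inner_term s1 s2 lam t (Suc k))) \<le> t / (R * x) * (A k * (1/2) ^ k)) sequentially"
  proof eventually_elim
    case (elim k)
    have "norm (inner_term s1 s2 lam t (Suc k)) = t ^ Suc k * A k / norm (Gamma (s1 + of_nat (Suc k)))"
      using t by (simp add: inner_term_def A_def norm_mult norm_divide norm_power)
    also have "\<dots> \<le> t ^ Suc k * A k / (R * x * fact k)"
    proof (rule divide_left_mono)
      have "R * x * fact k > 0" using R x by simp
      with lower[of k] show "0 < norm (Gamma (s1 + of_nat (Suc k))) * (R * x * fact k)"
        by (metis mult_pos_pos less_le_trans)
    qed (use lower t in \<open>auto simp: A_def\<close>)
    also have "\<dots> = t / (R * x) * (A k * (1/2) ^ k) * ((2 * t) ^ k / fact k)"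
      by (simp add: power_mult_distrib power_divide)
    also have "\<dots> \<le> t / (R * x) * (A k * (1/2) ^ k) * 1"
      using elim R x t by (intro mult_left_mono) (auto simp: A_def)
    finally show ?case by simp
  qed
  thus ?thesis
    by (rule summable_comparison_test_ev) (intro summable_mult sA)
qed

section \<open>Exchange of sum and integral\<close>

text \<open>Absorbing \<open>t ^ k\<close> into the kernel makes every term of the expanded
  integrand a multiple of a kernel with known integral.\<close>

lemma zeta_kernel_shift:
  "zeta_kernel (s + of_nat k) t = zeta_kernel s t * of_real t ^ k"
proof (cases "t > 0")
  case True
  have "complex_of_real t powr (s - 1 + of_nat k) = of_real t powr (s - 1) * of_real t ^ k"
    using True by (subst powr_add) simp
  hence "complex_of_real t powr (s + of_nat k - 1) = of_real t powr (s - 1) * of_real t ^ k"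
    by (simp add: algebra_simps)
  thus ?thesis by (simp add: zeta_kernel_def)
qed (simp add: zeta_kernel_def)

text \<open>Infinite sums and integrals are total functions in HOL, so convergence and integrability
  are asserted alongside the identity to exclude an equation between default values.\<close>

theorem lemma4p1:
  fixes s1 s2 lam :: complex
  assumes "Re s1 > 0"
    and "lam \<notin> {of_int n | n. n < 0}"
  shows "summable (\<lambda>k. D_term s1 s2 lam (Suc k)) \<and>
    (\<forall>t>0. summable (\<lambda>k. inner_term s1 s2 lam t (Suc k))) \<and>
    set_integrable lborel {0<..} (D_integrand s1 s2 lam) \<and>
    D s1 s2 lam = (LBINT t:{0<..}. D_integrand s1 s2 lam t)"
proof -
  have s1: "Re s1 > 0" by fact
  define a where "a = (\<lambda>k. (of_nat (Suc k) + lam) powr (- s2))"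
  define G where "G = (\<lambda>k. Gamma (s1 + of_nat (Suc k)))"
  \<comment> \<open>Dividing by \<open>G k\<close> cancels the Gamma factor of the integral formula,
    so \<open>F k\<close> integrates exactly to the corresponding term of \<open>D\<close>.\<close>
  define F where "F = (\<lambda>k t. a k / G k * zeta_kernel (s1 + of_nat (Suc k)) t)"
  have G: "G k \<noteq> 0" for k
    using s1 Re_pos_not_nonpos_Ints[of "s1 + of_nat (Suc k)"] by (simp add: G_def Gamma_eq_zero_iff)
  have F: "has_bochner_integral lborel (F k) (D_term s1 s2 lam (Suc k))" for k
  proof -
    have "has_bochner_integral lborel (F k)
            (a k / G k * (G k * (riemann_zeta (s1 + of_nat (Suc k)) - 1)))"
      unfolding F_def G_def using s1
      by (intro has_bochner_integral_mult_right has_bochner_integral_zeta_kernel) simp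
    also have "a k / G k * (G k * (riemann_zeta (s1 + of_nat (Suc k)) - 1)) = D_term s1 s2 lam (Suc k)"
      using G[of k] by (simp add: D_term_def a_def powr_minus divide_inverse)
    finally show ?thesis .
  qed
  have F_inner: "F k t = zeta_kernel s1 t * inner_term s1 s2 lam t (Suc k)" for k t
    unfolding F_def inner_term_def zeta_kernel_shift by (simp add: a_def G_def)
  have inner: "summable (\<lambda>k. norm (inner_term s1 s2 lam t (Suc k)))" if "t > 0" for t
    by (rule summable_norm_inner_term[OF s1 that])
  have ptwise: "summable (\<lambda>k. norm (F k t))" for t
  proof (cases "t > 0")
    case True
    thus ?thesis unfolding F_inner norm_mult by (intro summable_mult inner)
  qed (simp add: F_def zeta_kernel_def)
  have sum_F: "(\<Sum>k. F k t) = indicator {0<..} t *\<^sub>R D_integrand s1 s2 lam t" for t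
  proof (cases "t > 0")
    case True
    thus ?thesis
      unfolding F_inner suminf_mult[OF summable_norm_cancel[OF inner[OF True]]]
      by (simp add: D_integrand_def zeta_kernel_def)
  qed (simp add: F_def zeta_kernel_def)
  have norm_int: "(\<integral>t. norm (F k t) \<partial>lborel) \<le>
      Gamma (Re s1) / norm (Gamma s1) * (\<Sum>n. (real n + 2) powr (- (Re s1 + 1))) *
      (norm (a k) * (1/2) ^ k)" for k
  proof -
    define x where "x = Re s1"
    let ?z = "riemann_zeta (of_real x + of_nat (Suc k)) - 1"
    \<comment> \<open>The index starts at 1, so \<open>x + Suc k\<close> is read as
      \<open>(x + 1) + k\<close>: the decay estimate starts from \<open>x + 1 > 1\<close>.\<close>
    define Z where "Z = (\<Sum>n. (real n + 2) powr (- (x + 1)))"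
    have x: "x > 0" using s1 by (simp add: x_def)
    have "has_bochner_integral lborel (\<lambda>t. Re (zeta_kernel (of_real x + of_nat (Suc k)) t))
            (Re (Gamma (of_real x + of_nat (Suc k)) * ?z))"
      using x by (intro has_bochner_integral_Re has_bochner_integral_zeta_kernel) auto
    hence "has_bochner_integral lborel (\<lambda>t. norm (zeta_kernel (s1 + of_nat (Suc k)) t))
            (Re (Gamma (of_real x + of_nat (Suc k)) * ?z))"
      by (simp add: norm_zeta_kernel[of "s1 + _"] x_def)
    hence "(\<integral>t. norm (F k t) \<partial>lborel) = norm (a k) / norm (G k) * Re (Gamma (of_real x + of_nat (Suc k)) * ?z)"
      by (simp add: F_def norm_mult norm_divide has_bochner_integral_iff)
    also have "\<dots> \<le> norm (a k) / norm (G k) * (Gamma (x + real (Suc k)) * ((1/2) ^ k * Z))"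
    proof (rule mult_left_mono)
      have pos: "Gamma (x + real (Suc k)) > 0" using x by (intro Gamma_real_pos) simp
      have "Gamma (complex_of_real x + of_nat (Suc k)) = of_real (Gamma (x + real (Suc k)))"
        by (subst Gamma_complex_of_real [symmetric]) simp
      hence "Re (Gamma (of_real x + of_nat (Suc k)) * ?z) = Gamma (x + real (Suc k)) * Re ?z"
        by simp
      also have "\<dots> \<le> Gamma (x + real (Suc k)) * ((1/2) ^ k * Z)"
      proof (rule mult_left_mono)
        have "Re ?z \<le> norm ?z" by (rule complex_Re_le_cmod)
        also have "\<dots> \<le> (1/2) ^ k * Z"
          using norm_riemann_zeta_minus_1_le[of "of_real x + 1" k] x by (simp add: Z_def add_ac)
        finally show "Re ?z \<le> (1/2) ^ k * Z" .
      qed (use pos in simp)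
      finally show "Re (Gamma (of_real x + of_nat (Suc k)) * ?z) \<le> Gamma (x + real (Suc k)) * ((1/2) ^ k * Z)" .
    qed simp
    also have "\<dots> =
       Gamma (x + real (Suc k)) / norm (G k) * (Z * (norm (a k) * (1/2) ^ k))"
      by simp
    \<comment> \<open>The bounded Gamma ratio leaves \<open>k\<close> only in the coefficient
      \<open>a k\<close> and the power of 1/2.\<close>
    also have "\<dots> \<le> Gamma x / norm (Gamma s1) * (Z * (norm (a k) * (1/2) ^ k))"
    proof (rule mult_right_mono)
      have "norm (Gamma s1) > 0"
        using s1 Re_pos_not_nonpos_Ints[of s1] by (simp add: Gamma_eq_zero_iff)
      thus "Gamma (x + real (Suc k)) / norm (G k) \<le> Gamma x / norm (Gamma s1)"
        using norm_Gamma_plus_of_nat_ge[OF s1, of "Suc k"] G[of k]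
        by (simp add: G_def x_def divide_simps mult_ac)
      have "Z \<ge> 0"
        unfolding Z_def using x by (intro suminf_nonneg summable_shifted_powr) auto
      thus "0 \<le> Z * (norm (a k) * (1/2) ^ k)" by simp
    qed
    finally show ?thesis by (simp add: Z_def x_def mult_ac)
  qed
  have sm: "summable (\<lambda>k. \<integral>t. norm (F k t) \<partial>lborel)"
  proof (rule summable_comparison_test')
    show "summable (\<lambda>k. Gamma (Re s1) / norm (Gamma s1) *
            (\<Sum>n. (real n + 2) powr (- (Re s1 + 1))) * (norm (a k) * (1/2) ^ k))"
      unfolding a_def by (intro summable_mult summable_norm_shifted_powr_half_power)
    show "norm (\<integral>t. norm (F k t) \<partial>lborel) \<le> Gamma (Re s1) / norm (Gamma s1) *
            (\<Sum>n. (real n + 2) powr (- (Re s1 + 1))) * (norm (a k) * (1/2) ^ k)" for k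
      using norm_int[of k] by simp
  qed
  have int: "integrable lborel (F k)" for k
    using F[of k] by (simp add: has_bochner_integral_iff)
  have "integrable lborel (\<lambda>t. \<Sum>k. F k t)"
    by (intro integrable_suminf int AE_I2 ptwise sm)
  hence 1: "set_integrable lborel {0<..} (D_integrand s1 s2 lam)"
    unfolding sum_F set_integrable_def .
  have "(\<lambda>k. integral\<^sup>L lborel (F k)) sums (\<integral>t. (\<Sum>k. F k t) \<partial>lborel)"
    by (intro sums_integral int AE_I2 ptwise sm)
  hence 2: "(\<lambda>k. D_term s1 s2 lam (Suc k)) sums (LBINT t:{0<..}. D_integrand s1 s2 lam t)"
    unfolding sum_F set_lebesgue_integral_def using F by (simp add: has_bochner_integral_iff)
  show ?thesis
    using 1 2 summable_norm_cancel[OF inner] by (auto simp: D_def sums_iff)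
qed

end
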